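(* For each $z\in\mathbb{R}^n$, a sample of $\breve\delta(z)$ may be computed as $\gamma(z)\,\nu_u$ where $\nu_u\sim\mathcal N(0,W_u^{-1})$; that is, the random vectors $\breve\delta(z)$ and $\gamma(z)\nu_u$ in $\mathbb{R}^m$ have the same distribution, where $$\gamma(z)=\sqrt{(z-\tilde z)^T\left(W_z^{-1}-W_z^{-1}Z_c\left(Z_c^TW_z^{-1}Z_c\right)^{-1}Z_c^TW_z^{-1}\right)(z-\tilde z)}$$ and $Z_c=\begin{pmatrix} z_2-\tilde z&\cdots&z_N-\tilde z\end{pmatrix}\in\mathbb{R}^{n\times(N-1)}$.
   Context: Let $m,n,N$ be positive integers and $p=m(n+1)$. Let $M_z\in\mathbb{R}^{n\times n}$, $W_u\in\mathbb{R}^{m\times m}$ and $W_z\in\mathbb{R}^{n\times n}$ be symmetric positive definite, and let $W_z^{-1/2}$ be the symmetric positive definite square root of $W_z^{-1}$. Let $\tilde z\in\mathbb{R}^n$ and let $z_1,\dots,z_N\in\mathbb{R}^n$ be linearly independent with $z_1=\tilde z$. If $N=1$, $Z_c$ is empty and the term containing $Z_c$ is absent. $\mathcal N(0,C)$ denotes the Gaussian distribution with mean $0$ and covariance $C$, and $\otimes$ is the Kronecker product. The model discrepancy is $\delta(z,\theta)=\begin{pmatrix} I_m & I_m\otimes z^TM_z\end{pmatrix}\theta\in\mathbb{R}^m$ for $z\in\mathbb{R}^n$, $\theta\in\mathbb{R}^p$. Let $\{\breve z_1,\dots,\breve z_{n-N+1}\}\subset\mathbb{R}^n$ be an orthonormal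 set (Euclidean inner product) of vectors orthogonal to $\{W_z^{-1/2}(z_\ell-\tilde z)\}_{\ell=2}^N$, and let $\breve u_1,\dots,\breve u_{n-N+1}\sim\mathcal N(0,W_u^{-1})$ be independent. Define the random vector $$\breve\theta=\sum_{k=1}^{n-N+1}\begin{pmatrix}\breve s_k\,\breve u_k\\ \breve u_k\otimes\breve y_k\end{pmatrix}\in\mathbb{R}^p,\qquad \breve s_k=-\tilde z^TW_z^{-1/2}\breve z_k,\quad \breve y_k=M_z^{-1}W_z^{-1/2}\breve z_k,$$ and $$\breve\delta(z)=\delta(z,\breve\theta)=\sum_{k=1}^{n-N+1}\left(\breve z_k^TW_z^{-1/2}(z-\tilde z)\right)\breve u_k .$$ *)

theory Defs
  imports "HOL-Analysis.Analysis" "HOL-Probability.Probability"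
begin

definition spd :: "real^'n^'n \<Rightarrow> bool" where
  "spd A \<longleftrightarrow> transpose A = A \<and> (\<forall>x. x \<noteq> 0 \<longrightarrow> x \<bullet> (A *v x) > 0)"

text \<open>Lebesgue density of the Gaussian distribution with mean zero and covariance \<open>C\<close>,
  meant for positive definite \<open>C\<close> only.\<close>

definition gaussian_density :: "real^'m^'m \<Rightarrow> real^'m \<Rightarrow> real" where
  "gaussian_density C x =
     exp (- (x \<bullet> (matrix_inv C *v x)) / 2) / sqrt ((2 * pi) ^ CARD('m) * det C)"

text \<open>Kronecker products are indexed by pairs, the index of the left factor coming first, and
  the concatenation of two vectors is indexed by a disjoint sum. Thus \<open>\<real>\<^sup>p\<close> with
  \<open>p = m (n + 1)\<close> is the type \<open>real^('m + 'm \<times> 'n)\<close>.\<close>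

definition kron :: "real^'b^'a \<Rightarrow> real^'d^'c \<Rightarrow> real^('b \<times> 'd)^('a \<times> 'c)" where
  "kron A B = (\<chi> r s. A $ fst r $ fst s * B $ snd r $ snd s)"

definition kron_vec :: "real^'a \<Rightarrow> real^'b \<Rightarrow> real^('a \<times> 'b)" where
  "kron_vec u y = (\<chi> r. u $ fst r * y $ snd r)"

definition stack_vec :: "real^'a \<Rightarrow> real^'b \<Rightarrow> real^('a + 'b)" where
  "stack_vec a b = (\<chi> s. case s of Inl i \<Rightarrow> a $ i | Inr j \<Rightarrow> b $ j)"

text \<open>The block row \<open>(I\<^sub>m, I\<^sub>m \<otimes> z\<^sup>T M\<^sub>z)\<close>; the rows of the Kronecker product
  are indexed by \<open>'m \<times> 1\<close> and identified with \<open>'m\<close>.\<close>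

definition discrepancy_matrix :: "real^'n^'n \<Rightarrow> real^'n \<Rightarrow> real^('m + 'm \<times> 'n)^'m" where
  "discrepancy_matrix Mz z =
     (\<chi> i s. case s of
        Inl j \<Rightarrow> (mat 1 :: real^'m^'m) $ i $ j
      | Inr q \<Rightarrow> kron (mat 1 :: real^'m^'m) ((rowvector z :: real^'n^1) ** Mz) $ (i, 1) $ q)"

definition discrepancy :: "real^'n^'n \<Rightarrow> real^'n \<Rightarrow> real^('m + 'm \<times> 'n) \<Rightarrow> real^'m" where
  "discrepancy Mz z \<theta> = discrepancy_matrix Mz z *v \<theta>"

text \<open>In what follows \<open>R\<close> is the square root \<open>W\<^sub>z\<^sup>-\<^sup>1\<^sup>/\<^sup>2\<close>, \<open>zt\<close> is the point \<open>z\<^sub>1\<close>, and \<open>K\<close> is the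
  number \<open>n - N + 1\<close> of directions \<open>zb k\<close>.\<close>

definition breve_s :: "real^'n^'n \<Rightarrow> real^'n \<Rightarrow> (nat \<Rightarrow> real^'n) \<Rightarrow> nat \<Rightarrow> real" where
  "breve_s R zt zb k = - (zt \<bullet> (R *v zb k))"

definition breve_y :: "real^'n^'n \<Rightarrow> real^'n^'n \<Rightarrow> (nat \<Rightarrow> real^'n) \<Rightarrow> nat \<Rightarrow> real^'n" where
  "breve_y Mz R zb k = matrix_inv Mz *v (R *v zb k)"

definition breve_theta ::
  "real^'n^'n \<Rightarrow> real^'n^'n \<Rightarrow> real^'n \<Rightarrow> nat \<Rightarrow> (nat \<Rightarrow> real^'n) \<Rightarrow> (nat \<Rightarrow> 'a \<Rightarrow> real^'m)
    \<Rightarrow> 'a \<Rightarrow> real^('m + 'm \<times> 'n)" where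
  "breve_theta Mz R zt K zb ub \<omega> =
     (\<Sum>k=1..K. stack_vec (breve_s R zt zb k *\<^sub>R ub k \<omega>) (kron_vec (ub k \<omega>) (breve_y Mz R zb k)))"

definition breve_delta ::
  "real^'n^'n \<Rightarrow> real^'n^'n \<Rightarrow> real^'n \<Rightarrow> nat \<Rightarrow> (nat \<Rightarrow> real^'n) \<Rightarrow> (nat \<Rightarrow> 'a \<Rightarrow> real^'m)
    \<Rightarrow> real^'n \<Rightarrow> 'a \<Rightarrow> real^'m" where
  "breve_delta Mz R zt K zb ub z \<omega> = discrepancy Mz z (breve_theta Mz R zt K zb ub \<omega>)"

text \<open>The columns of \<open>Z\<^sub>c\<close> are indexed by a finite type \<open>'c\<close>, which \<open>col\<close> enumerates by the
  numbers \<open>2, \<dots>, N\<close>. Since types are not empty, \<open>N = 1\<close> is a separate case in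
  \<open>gamma_matrix\<close>, where \<open>'c\<close> and \<open>col\<close> play no role.\<close>

definition Z_c :: "('c \<Rightarrow> nat) \<Rightarrow> (nat \<Rightarrow> real^'n) \<Rightarrow> real^'n \<Rightarrow> real^'c^'n" where
  "Z_c col zs zt = (\<chi> i j. (zs (col j) - zt) $ i)"

definition gamma_matrix ::
  "real^'n^'n \<Rightarrow> nat \<Rightarrow> ('c::finite \<Rightarrow> nat) \<Rightarrow> (nat \<Rightarrow> real^'n) \<Rightarrow> real^'n \<Rightarrow> real^'n^'n" where
  "gamma_matrix Wz N col zs zt =
     (if N = 1 then matrix_inv Wz
      else let Z = Z_c col zs zt; V = matrix_inv Wz in
        V - V ** Z ** matrix_inv (transpose Z ** V ** Z) ** transpose Z ** V)"

definition gamma ::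
  "real^'n^'n \<Rightarrow> nat \<Rightarrow> ('c::finite \<Rightarrow> nat) \<Rightarrow> (nat \<Rightarrow> real^'n) \<Rightarrow> real^'n \<Rightarrow> real^'n \<Rightarrow> real" where
  "gamma Wz N col zs zt z = sqrt ((z - zt) \<bullet> (gamma_matrix Wz N col zs zt *v (z - zt)))"

end

theory Submission imports Defs begin

text \<open>Put \<open>w = R (z - zt)\<close>. Since \<open>Mz\<close> is invertible and \<open>R\<close> is symmetric,
  \<open>breve_delta\<close> at \<open>z\<close> is the combination of the independent vectors \<open>ub k\<close> with
  coefficients \<open>zb k \<bullet> w\<close> (lemma \<open>breve_delta_eq\<close>). Two facts then give the claim.

  The first is probabilistic: a combination of independent copies of a centred Gaussian vector
  with coefficients \<open>a k\<close> is distributed like one copy scaled by the Euclidean norm of \<open>a\<close>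
  (lemma \<open>distr_sum_scaled_density\<close>). By induction it suffices to treat two copies and a
  coefficient pair \<open>(c, s)\<close> on the unit circle. The density of a pair of independent copies
  is a constant times \<open>exp (- (q x + q y) / 2)\<close> with a quadratic form \<open>q\<close>, so it does not change
  when \<open>(x, y)\<close> is replaced by \<open>(c x + s y, c y - s x)\<close>; Lebesgue measure does not change under
  this rotation either, and so the first component \<open>c x + s y\<close> has the distribution of \<open>x\<close>.

  The second is linear algebra: \<open>gamma\<close> squared is the sum of the \<open>(zb k \<bullet> w)\<^sup>2\<close>
  (lemma \<open>gamma_squared\<close>). The \<open>N - 1\<close> vectors \<open>R (zs l - zt)\<close> are linearly independent and
  orthogonal to the \<open>n - N + 1\<close> orthonormal vectors \<open>zb k\<close>, so the two families span two
  complementary orthogonal subspaces. With \<open>B = R Z\<close> the matrix \<open>B (B\<^sup>T B)\<^sup>-\<^sup>1 B\<^sup>T\<close> is the orthogonal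
  projection onto the span of the first family, and \<open>gamma\<close> is the norm of what remains of \<open>w\<close>,
  which is its component along the \<open>zb k\<close>.\<close>

section \<open>Rotation-invariant densities and sums of independent copies\<close>

lemma nn_integral_lborel_affine:
  fixes g :: "'a::euclidean_space \<Rightarrow> ennreal"
  assumes [measurable]: "g \<in> borel_measurable borel" and c: "c \<noteq> 0"
  shows "(\<integral>\<^sup>+x. g x \<partial>lborel) = ennreal (\<bar>c\<bar> ^ DIM('a)) * (\<integral>\<^sup>+x. g (t + c *\<^sub>R x) \<partial>lborel)"
  by (subst lborel_affine[OF c, of t])
     (simp add: nn_integral_density nn_integral_distr nn_integral_cmult)

text \<open>Invariance of Lebesgue measure under a rotation of pairs, weighted by a density that the
  rotation preserves. Only affine substitutions in one variable at a time are used: with \<open>y\<close> fixed,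
  \<open>x\<close> is traded for \<open>w = c x + s y\<close>; after exchanging the integrals, with \<open>w\<close> fixed, \<open>y\<close> is traded
  for \<open>v = c y - s x\<close>, which in terms of \<open>w\<close> is \<open>(y - s w) / c\<close>. The two Jacobian factors are
  inverse to each other, and the integral over \<open>v\<close> is the total mass.\<close>

lemma nn_integral_rotated_density:
  fixes f F :: "'a::euclidean_space \<Rightarrow> ennreal"
  assumes [measurable]: "f \<in> borel_measurable borel" "F \<in> borel_measurable borel"
    and inv: "\<And>x y. f x * f y = f (c *\<^sub>R x + s *\<^sub>R y) * f (c *\<^sub>R y - s *\<^sub>R x)"
    and cs: "c\<^sup>2 + s\<^sup>2 = 1" and c: "c \<noteq> 0"
    and total: "(\<integral>\<^sup>+x. f x \<partial>lborel) = 1"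
  shows "(\<integral>\<^sup>+y. \<integral>\<^sup>+x. F (c *\<^sub>R x + s *\<^sub>R y) * (f x * f y) \<partial>lborel \<partial>lborel) = (\<integral>\<^sup>+w. F w * f w \<partial>lborel)"
proof -
  define C where "C = ennreal (\<bar>c\<bar> ^ DIM('a))"
  have C: "C \<noteq> 0" "C \<noteq> top" using c by (auto simp: C_def)
  have cc: "1 - s * s = c * c"
    using cs by (simp add: power2_eq_square)
  have turn: "f ((w - s *\<^sub>R y) /\<^sub>R c) * f y = f w * f ((y - s *\<^sub>R w) /\<^sub>R c)" for w y
  proof -
    define x where "x = (w - s *\<^sub>R y) /\<^sub>R c"
    have w: "w = c *\<^sub>R x + s *\<^sub>R y" using c by (simp add: x_def)
    have "y - s *\<^sub>R w = (1 - s * s) *\<^sub>R y - (s * c) *\<^sub>R x"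
      by (simp add: w algebra_simps)
    also have "\<dots> = c *\<^sub>R (c *\<^sub>R y - s *\<^sub>R x)"
      by (simp add: cc algebra_simps)
    finally have "(y - s *\<^sub>R w) /\<^sub>R c = c *\<^sub>R y - s *\<^sub>R x"
      using c by simp
    then show "f ((w - s *\<^sub>R y) /\<^sub>R c) * f y = f w * f ((y - s *\<^sub>R w) /\<^sub>R c)"
      using inv[of x y] by (simp only: x_def[symmetric] w[symmetric])
  qed
  \<comment> \<open>Multiplying by the Jacobian \<open>C\<close> first avoids division in \<open>ennreal\<close>.\<close>
  have "C * (\<integral>\<^sup>+y. \<integral>\<^sup>+x. F (c *\<^sub>R x + s *\<^sub>R y) * (f x * f y) \<partial>lborel \<partial>lborel)
      = (\<integral>\<^sup>+y. C * (\<integral>\<^sup>+x. F (c *\<^sub>R x + s *\<^sub>R y) * (f x * f y) \<partial>lborel) \<partial>lborel)"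
    by (subst nn_integral_cmult) simp_all
  also have "\<dots> = (\<integral>\<^sup>+y. \<integral>\<^sup>+w. F w * (f ((w - s *\<^sub>R y) /\<^sub>R c) * f y) \<partial>lborel \<partial>lborel)"
  proof (rule nn_integral_cong)
    fix y
    have "(\<integral>\<^sup>+w. F w * (f ((w - s *\<^sub>R y) /\<^sub>R c) * f y) \<partial>lborel)
        = C * (\<integral>\<^sup>+x. F (s *\<^sub>R y + c *\<^sub>R x) * (f ((s *\<^sub>R y + c *\<^sub>R x - s *\<^sub>R y) /\<^sub>R c) * f y) \<partial>lborel)"
      unfolding C_def by (rule nn_integral_lborel_affine[OF _ c]) measurable
    then show "C * (\<integral>\<^sup>+x. F (c *\<^sub>R x + s *\<^sub>R y) * (f x * f y) \<partial>lborel)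
        = (\<integral>\<^sup>+w. F w * (f ((w - s *\<^sub>R y) /\<^sub>R c) * f y) \<partial>lborel)"
      using c by (simp add: add.commute)
  qed
  also have "\<dots> = (\<integral>\<^sup>+y. \<integral>\<^sup>+w. F w * f w * f ((y - s *\<^sub>R w) /\<^sub>R c) \<partial>lborel \<partial>lborel)"
    by (simp add: turn mult.assoc)
  also have "\<dots> = (\<integral>\<^sup>+w. \<integral>\<^sup>+y. F w * f w * f ((y - s *\<^sub>R w) /\<^sub>R c) \<partial>lborel \<partial>lborel)"
    by (rule lborel_pair.Fubini') measurable
  also have "\<dots> = (\<integral>\<^sup>+w. F w * f w * (\<integral>\<^sup>+y. f ((y - s *\<^sub>R w) /\<^sub>R c) \<partial>lborel) \<partial>lborel)"
    by (subst nn_integral_cmult) simp_all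
  also have "\<dots> = (\<integral>\<^sup>+w. F w * f w * C \<partial>lborel)"
  proof (rule nn_integral_cong)
    fix w
    have "(\<integral>\<^sup>+y. f ((y - s *\<^sub>R w) /\<^sub>R c) \<partial>lborel)
        = C * (\<integral>\<^sup>+v. f ((s *\<^sub>R w + c *\<^sub>R v - s *\<^sub>R w) /\<^sub>R c) \<partial>lborel)"
      unfolding C_def by (rule nn_integral_lborel_affine[OF _ c]) measurable
    then show "F w * f w * (\<integral>\<^sup>+y. f ((y - s *\<^sub>R w) /\<^sub>R c) \<partial>lborel) = F w * f w * C"
      using c total by simp
  qed
  also have "\<dots> = C * (\<integral>\<^sup>+w. F w * f w \<partial>lborel)"
    by (subst nn_integral_multc) (simp_all add: mult.commute)
  finally show ?thesis
    using C by (simp add: ennreal_mult_cancel_left)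
qed

lemma distr_rotated_density_nonzero:
  fixes f :: "'a::euclidean_space \<Rightarrow> ennreal"
  assumes f[measurable]: "f \<in> borel_measurable borel"
    and inv: "\<And>x y. f x * f y = f (c *\<^sub>R x + s *\<^sub>R y) * f (c *\<^sub>R y - s *\<^sub>R x)"
    and cs: "c\<^sup>2 + s\<^sup>2 = 1" and c: "c \<noteq> 0"
    and \<mu>: "\<mu> = density lborel f" and "prob_space \<mu>"
  shows "distr (\<mu> \<Otimes>\<^sub>M \<mu>) borel (\<lambda>(x, y). c *\<^sub>R x + s *\<^sub>R y) = \<mu>"
proof (rule measure_eqI)
  interpret \<mu>: prob_space \<mu> by fact
  interpret pair: pair_prob_space \<mu> \<mu> ..
  have sets_\<mu>[measurable_cong]: "sets \<mu> = sets borel" by (simp add: \<mu>)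
  show "sets (distr (\<mu> \<Otimes>\<^sub>M \<mu>) borel (\<lambda>(x, y). c *\<^sub>R x + s *\<^sub>R y)) = sets \<mu>"
    by (simp add: \<mu>)
  fix A assume "A \<in> sets (distr (\<mu> \<Otimes>\<^sub>M \<mu>) borel (\<lambda>(x, y). c *\<^sub>R x + s *\<^sub>R y))"
  then have A[measurable]: "A \<in> sets borel" by simp
  have total: "(\<integral>\<^sup>+x. f x \<partial>lborel) = 1"
    using \<mu>.emeasure_space_1 by (simp add: \<mu> emeasure_density)
  have "emeasure (distr (\<mu> \<Otimes>\<^sub>M \<mu>) borel (\<lambda>(x, y). c *\<^sub>R x + s *\<^sub>R y)) A
      = (\<integral>\<^sup>+w. indicator A w \<partial>distr (\<mu> \<Otimes>\<^sub>M \<mu>) borel (\<lambda>(x, y). c *\<^sub>R x + s *\<^sub>R y))"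
    by simp
  also have "\<dots> = (\<integral>\<^sup>+p. indicator A (c *\<^sub>R fst p + s *\<^sub>R snd p) \<partial>(\<mu> \<Otimes>\<^sub>M \<mu>))"
    by (subst nn_integral_distr) (simp_all add: case_prod_beta)
  also have "\<dots> = (\<integral>\<^sup>+y. \<integral>\<^sup>+x. indicator A (c *\<^sub>R x + s *\<^sub>R y) \<partial>\<mu> \<partial>\<mu>)"
    by (subst pair.nn_integral_snd[symmetric]) (simp_all add: case_prod_beta)
  also have "\<dots> = (\<integral>\<^sup>+y. \<integral>\<^sup>+x. indicator A (c *\<^sub>R x + s *\<^sub>R y) * (f x * f y) \<partial>lborel \<partial>lborel)"
    unfolding \<mu>
    by (simp add: nn_integral_density nn_integral_cmult[symmetric] mult_ac)
  also have "\<dots> = (\<integral>\<^sup>+w. indicator A w * f w \<partial>lborel)"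
    by (rule nn_integral_rotated_density[OF f _ inv cs c total]) simp
  also have "\<dots> = emeasure \<mu> A"
    by (simp add: \<mu> emeasure_density mult.commute)
  finally show "emeasure (distr (\<mu> \<Otimes>\<^sub>M \<mu>) borel (\<lambda>(x, y). c *\<^sub>R x + s *\<^sub>R y)) A = emeasure \<mu> A" .
qed

text \<open>When \<open>c = 0\<close> the substitution for \<open>x\<close> is not available, but then \<open>s\<close> is nonzero, and
  the two independent copies may be exchanged.\<close>

lemma distr_rotated_density:
  fixes f :: "'a::euclidean_space \<Rightarrow> ennreal"
  assumes f[measurable]: "f \<in> borel_measurable borel"
    and inv: "\<And>c s x y. c\<^sup>2 + s\<^sup>2 = 1 \<Longrightarrow>
      f x * f y = f (c *\<^sub>R x + s *\<^sub>R y) * f (c *\<^sub>R y - s *\<^sub>R x)"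
    and cs: "c\<^sup>2 + s\<^sup>2 = 1"
    and \<mu>: "\<mu> = density lborel f" and "prob_space \<mu>"
  shows "distr (\<mu> \<Otimes>\<^sub>M \<mu>) borel (\<lambda>(x, y). c *\<^sub>R x + s *\<^sub>R y) = \<mu>"
proof (cases "c = 0")
  case False
  then show ?thesis
    by (rule distr_rotated_density_nonzero[OF f inv[OF cs] cs _ \<mu> \<open>prob_space \<mu>\<close>])
next
  case True
  with cs have s: "s \<noteq> 0" and sc: "s\<^sup>2 + c\<^sup>2 = 1" by (auto simp: add.commute)
  interpret \<mu>: prob_space \<mu> by fact
  interpret pair: pair_prob_space \<mu> \<mu> ..
  have sets_\<mu>[measurable_cong]: "sets \<mu> = sets borel" by (simp add: \<mu>)
  have "distr (\<mu> \<Otimes>\<^sub>M \<mu>) borel (\<lambda>(x, y). c *\<^sub>R x + s *\<^sub>R y)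
      = distr (distr (\<mu> \<Otimes>\<^sub>M \<mu>) (\<mu> \<Otimes>\<^sub>M \<mu>) (\<lambda>(x, y). (y, x))) borel (\<lambda>(x, y). c *\<^sub>R x + s *\<^sub>R y)"
    by (simp add: pair.distr_pair_swap[symmetric])
  also have "\<dots> = distr (\<mu> \<Otimes>\<^sub>M \<mu>) borel (\<lambda>(x, y). s *\<^sub>R x + c *\<^sub>R y)"
    by (subst distr_distr) (simp_all add: case_prod_beta' comp_def add.commute)
  also have "\<dots> = \<mu>"
    by (rule distr_rotated_density_nonzero[OF f inv[OF sc] sc s \<mu> \<open>prob_space \<mu>\<close>])
  finally show ?thesis .
qed

text \<open>Dividing by \<open>sqrt (a\<^sup>2 + b\<^sup>2)\<close> puts the coefficients on the unit circle; if it vanishes,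
  both sides are the point mass at zero.\<close>

lemma distr_add_scaled_density:
  fixes f :: "'a::euclidean_space \<Rightarrow> ennreal"
  assumes f[measurable]: "f \<in> borel_measurable borel"
    and inv: "\<And>c s x y. c\<^sup>2 + s\<^sup>2 = 1 \<Longrightarrow>
      f x * f y = f (c *\<^sub>R x + s *\<^sub>R y) * f (c *\<^sub>R y - s *\<^sub>R x)"
    and \<mu>: "\<mu> = density lborel f" and "prob_space \<mu>"
  shows "distr (\<mu> \<Otimes>\<^sub>M \<mu>) borel (\<lambda>(x, y). a *\<^sub>R x + b *\<^sub>R y)
       = distr \<mu> borel (\<lambda>x. sqrt (a\<^sup>2 + b\<^sup>2) *\<^sub>R x)"
proof -
  interpret \<mu>: prob_space \<mu> by fact
  interpret pair: pair_prob_space \<mu> \<mu> ..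
  have sets_\<mu>[measurable_cong]: "sets \<mu> = sets borel" by (simp add: \<mu>)
  define r where "r = sqrt (a\<^sup>2 + b\<^sup>2)"
  show ?thesis
  proof (cases "r = 0")
    case True
    then have "a = 0" "b = 0"
      by (simp_all add: r_def sum_power2_eq_zero_iff)
    then show ?thesis
      by (simp add: pair.distr_const[of 0 borel] \<mu>.distr_const case_prod_beta')
  next
    case False
    have "r\<^sup>2 = a\<^sup>2 + b\<^sup>2" by (simp add: r_def)
    then have circle: "(a / r)\<^sup>2 + (b / r)\<^sup>2 = 1"
      using False unfolding power_divide add_divide_distrib[symmetric]
      by (metis divide_self power_eq_0_iff)
    have "distr (\<mu> \<Otimes>\<^sub>M \<mu>) borel (\<lambda>(x, y). a *\<^sub>R x + b *\<^sub>R y)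
        = distr (distr (\<mu> \<Otimes>\<^sub>M \<mu>) borel (\<lambda>(x, y). (a / r) *\<^sub>R x + (b / r) *\<^sub>R y)) borel (\<lambda>x. r *\<^sub>R x)"
      using False by (subst distr_distr) (simp_all add: comp_def case_prod_beta' scaleR_add_right)
    also have "\<dots> = distr \<mu> borel (\<lambda>x. r *\<^sub>R x)"
      by (simp only: distr_rotated_density[OF f inv circle \<mu> \<open>prob_space \<mu>\<close>])
    finally show ?thesis by (simp add: r_def)
  qed
qed

lemma (in prob_space) indep_var_scaled_sum:
  fixes X :: "'i \<Rightarrow> 'a \<Rightarrow> 'b::euclidean_space"
  assumes I: "finite I" "i \<notin> I" and indep: "indep_vars (\<lambda>_. borel) X (insert i I)"
  shows "indep_var borel (\<lambda>\<omega>. \<Sum>j\<in>I. a j *\<^sub>R X j \<omega>) borel (X i)"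
proof -
  have "indep_var
    borel ((\<lambda>f. \<Sum>j\<in>I. a j *\<^sub>R f j) \<circ> (\<lambda>\<omega>. restrict (\<lambda>j. X j \<omega>) I))
    borel ((\<lambda>f. f i) \<circ> (\<lambda>\<omega>. restrict (\<lambda>j. X j \<omega>) {i}))"
    using I by (intro indep_var_compose[OF indep_var_restrict[OF indep]]) auto
  then show ?thesis
    by (simp add: comp_def cong: sum.cong)
qed

text \<open>In the induction step the partial sum, distributed like \<open>r x\<close> with
  \<open>r = sqrt (\<Sum>j\<in>I. (a j)\<^sup>2)\<close>, is independent of the new term, so that two copies of \<open>\<mu>\<close> with
  coefficients \<open>r\<close> and \<open>a i\<close> are to be added.\<close>

lemma (in prob_space) distr_sum_scaled_density:
  fixes f :: "'b::euclidean_space \<Rightarrow> ennreal" and X :: "'i \<Rightarrow> 'a \<Rightarrow> 'b"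
  assumes f[measurable]: "f \<in> borel_measurable borel"
    and inv: "\<And>c s x y. c\<^sup>2 + s\<^sup>2 = 1 \<Longrightarrow>
      f x * f y = f (c *\<^sub>R x + s *\<^sub>R y) * f (c *\<^sub>R y - s *\<^sub>R x)"
    and \<mu>: "\<mu> = density lborel f" and "prob_space \<mu>"
    and "finite I" and "indep_vars (\<lambda>_. borel) X I" and "\<And>i. i \<in> I \<Longrightarrow> distr M borel (X i) = \<mu>"
  shows "distr M borel (\<lambda>\<omega>. \<Sum>i\<in>I. a i *\<^sub>R X i \<omega>)
       = distr \<mu> borel (\<lambda>x. sqrt (\<Sum>i\<in>I. (a i)\<^sup>2) *\<^sub>R x)"
  using assms(5-)
proof (induction I)
  case empty
  interpret \<mu>: prob_space \<mu> by fact
  show ?case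
    by (simp add: distr_const \<mu>.distr_const)
next
  case (insert i I)
  interpret \<mu>: prob_space \<mu> by fact
  interpret pair: pair_prob_space \<mu> \<mu> ..
  have sets_\<mu>[measurable_cong]: "sets \<mu> = sets borel" by (simp add: \<mu>)
  define S where "S = (\<lambda>\<omega>. \<Sum>j\<in>I. a j *\<^sub>R X j \<omega>)"
  define r where "r = sqrt (\<Sum>j\<in>I. (a j)\<^sup>2)"
  have r2: "r\<^sup>2 = (\<Sum>j\<in>I. (a j)\<^sup>2)" by (simp add: r_def sum_nonneg)
  have S: "distr M borel S = distr \<mu> borel (\<lambda>x. r *\<^sub>R x)"
    unfolding S_def r_def
    by (rule insert.IH) (use insert.prems indep_vars_subset[of "\<lambda>_. borel" X "insert i I" I] in auto)
  have Xi: "distr M borel (X i) = \<mu>" using insert.prems by simp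
  have iv: "indep_var borel S borel (X i)"
    unfolding S_def using insert.hyps insert.prems by (intro indep_var_scaled_sum) auto
  then have [measurable]: "random_variable borel S" "random_variable borel (X i)"
    by (auto dest: indep_var_rv1 indep_var_rv2)
  have "distr M borel (\<lambda>\<omega>. \<Sum>j\<in>insert i I. a j *\<^sub>R X j \<omega>)
      = distr (distr M (borel \<Otimes>\<^sub>M borel) (\<lambda>\<omega>. (S \<omega>, X i \<omega>))) borel (\<lambda>(x, y). x + a i *\<^sub>R y)"
    using insert.hyps by (subst distr_distr) (measurable, simp add: comp_def S_def add.commute)
  also have "\<dots> = distr (distr M borel S \<Otimes>\<^sub>M distr M borel (X i)) borel (\<lambda>(x, y). x + a i *\<^sub>R y)"
    using iv by (simp add: indep_var_distribution_eq)
  also have "\<dots> = distr (distr \<mu> borel (\<lambda>x. r *\<^sub>R x) \<Otimes>\<^sub>M distr \<mu> borel (\<lambda>x. x)) borel (\<lambda>(x, y). x + a i *\<^sub>R y)"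
    by (simp add: S Xi distr_id2 sets_\<mu>)
  also have "\<dots> = distr (distr (\<mu> \<Otimes>\<^sub>M \<mu>) (borel \<Otimes>\<^sub>M borel) (\<lambda>(x, y). (r *\<^sub>R x, y))) borel (\<lambda>(x, y). x + a i *\<^sub>R y)"
    by (subst pair_measure_distr)
       (auto intro!: prob_space_imp_sigma_finite \<mu>.prob_space_distr)
  also have "\<dots> = distr (\<mu> \<Otimes>\<^sub>M \<mu>) borel (\<lambda>(x, y). r *\<^sub>R x + a i *\<^sub>R y)"
    by (subst distr_distr) (simp_all add: comp_def case_prod_beta')
  also have "\<dots> = distr \<mu> borel (\<lambda>x. sqrt (r\<^sup>2 + (a i)\<^sup>2) *\<^sub>R x)"
    by (rule distr_add_scaled_density[OF f inv \<mu> \<open>prob_space \<mu>\<close>])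
  finally show ?case
    using insert.hyps by (simp add: r2 add.commute)
qed

text \<open>The exponent is a quadratic form \<open>q\<close>, and the cross terms of
  \<open>q (c x + s y)\<close> and \<open>q (c y - s x)\<close> cancel. The normalising constant appears squared on both sides.\<close>

lemma gaussian_density_rotate:
  assumes "c\<^sup>2 + s\<^sup>2 = 1"
  shows "ennreal (gaussian_density C x) * ennreal (gaussian_density C y)
       = ennreal (gaussian_density C (c *\<^sub>R x + s *\<^sub>R y)) * ennreal (gaussian_density C (c *\<^sub>R y - s *\<^sub>R x))"
proof -
  define A where "A = matrix_inv C"
  define q where "q = (\<lambda>v. v \<bullet> (A *v v))"
  define D where "D = ennreal (1 / sqrt ((2 * pi) ^ CARD('a) * det C))"
  have dens: "ennreal (gaussian_density C v) = ennreal (exp (- q v / 2)) * D" for v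
    unfolding gaussian_density_def q_def A_def D_def
    by (subst ennreal_mult'[symmetric]) simp_all
  have "q (c *\<^sub>R x + s *\<^sub>R y) + q (c *\<^sub>R y - s *\<^sub>R x) = (c\<^sup>2 + s\<^sup>2) * (q x + q y)"
    by (simp add: q_def matrix_vector_right_distrib matrix_vector_mult_diff_distrib
        matrix_vector_mult_scaleR inner_simps power2_eq_square algebra_simps)
  then have q: "q x + q y = q (c *\<^sub>R x + s *\<^sub>R y) + q (c *\<^sub>R y - s *\<^sub>R x)"
    using assms by simp
  have prod: "ennreal (exp (- q v / 2)) * D * (ennreal (exp (- q w / 2)) * D)
      = ennreal (exp (- (q v + q w) / 2)) * (D * D)" for v w
  proof -
    have "exp (- (q v + q w) / 2) = exp (- q v / 2) * exp (- q w / 2)"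
      by (simp add: exp_add[symmetric] field_simps)
    then show ?thesis by (simp add: ennreal_mult mult_ac)
  qed
  show ?thesis
    by (simp only: dens prod q)
qed

section \<open>The discrepancy as a combination of the Gaussian vectors\<close>

lemma invertible_if_spd:
  assumes "spd A"
  shows "invertible A"
proof -
  have "x = 0" if "A *v x = 0" for x
    using assms that by (force simp: spd_def)
  then show ?thesis
    by (simp add: invertible_left_inverse matrix_left_invertible_ker)
qed

lemma matrix_inv_mult_vec:
  fixes A :: "real^'n^'n"
  assumes "invertible A"
  shows "A *v (matrix_inv A *v x) = x" "matrix_inv A *v (A *v x) = x"
proof -
  have "A ** matrix_inv A = mat 1 \<and> matrix_inv A ** A = mat 1"
    unfolding matrix_inv_def by (rule someI_ex) (use assms in \<open>simp add: invertible_def\<close>)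
  then show "A *v (matrix_inv A *v x) = x" "matrix_inv A *v (A *v x) = x"
    by (simp_all add: matrix_vector_mul_assoc)
qed

lemma symmetric_inner:
  fixes A :: "real^'n^'n"
  assumes "transpose A = A"
  shows "(A *v x) \<bullet> y = x \<bullet> (A *v y)"
  using assms by (metis dot_lmul_matrix transpose_matrix_vector)

text \<open>Each summand of \<open>breve_theta\<close> is sent to a multiple of \<open>u\<close>, by the mixed product rule
  \<open>(I \<otimes> z\<^sup>T M\<^sub>z) (u \<otimes> y) = u \<otimes> (z\<^sup>T M\<^sub>z y)\<close>, whose last factor is a number.\<close>

lemma discrepancy_stack_kron:
  fixes Mz :: "real^'n^'n" and u :: "real^'m"
  shows "discrepancy Mz z (stack_vec (r *\<^sub>R u) (kron_vec u y)) = (r + z \<bullet> (Mz *v y)) *\<^sub>R u"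
proof (subst vec_eq_iff, intro allI)
  fix i
  have row: "((rowvector z :: real^'n^1) ** Mz) $ 1 $ k = (\<Sum>l\<in>UNIV. z $ l * Mz $ l $ k)" for k
    by (simp add: matrix_matrix_mult_def rowvector_def)
  \<comment> \<open>The columns of the block row: \<open>Inl\<close> for the block \<open>I\<close>, \<open>Inr\<close> for the Kronecker block.\<close>
  have split: "(\<Sum>q\<in>UNIV. g q) = (\<Sum>j\<in>UNIV. g (Inl j)) + (\<Sum>j\<in>UNIV. \<Sum>k\<in>UNIV. g (Inr (j, k)))"
    for g :: "'m + 'm \<times> 'n \<Rightarrow> real"
    unfolding UNIV_Plus_UNIV[symmetric] UNIV_Times_UNIV[symmetric]
    by (subst sum.Plus) (simp_all add: sum.cartesian_product del: UNIV_Times_UNIV)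
  have "discrepancy Mz z (stack_vec (r *\<^sub>R u) (kron_vec u y)) $ i
      = (\<Sum>j\<in>UNIV. (if i = j then 1 else 0) * (r * u $ j))
        + (\<Sum>j\<in>UNIV. \<Sum>k\<in>UNIV. (if i = j then 1 else 0) * (\<Sum>l\<in>UNIV. z $ l * Mz $ l $ k) * (u $ j * y $ k))"
    unfolding discrepancy_def discrepancy_matrix_def matrix_vector_mult_def split
    by (simp add: stack_vec_def kron_vec_def kron_def mat_def row)
  also have "(\<Sum>j\<in>UNIV. (if i = j then 1 else 0) * (r * u $ j)) = r * u $ i"
    by (simp add: if_distrib[of "\<lambda>t. t * _"] cong: if_cong)
  also have "(\<Sum>j\<in>UNIV. \<Sum>k\<in>UNIV. (if i = j then 1 else 0) * (\<Sum>l\<in>UNIV. z $ l * Mz $ l $ k) * (u $ j * y $ k))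
      = (\<Sum>j\<in>UNIV. if i = j then (\<Sum>k\<in>UNIV. (\<Sum>l\<in>UNIV. z $ l * Mz $ l $ k) * (u $ j * y $ k)) else 0)"
    by (intro sum.cong) auto
  also have "\<dots> = (\<Sum>k\<in>UNIV. (\<Sum>l\<in>UNIV. z $ l * Mz $ l $ k) * (u $ i * y $ k))"
    by simp
  also have "\<dots> = (z \<bullet> (Mz *v y)) * u $ i"
  proof -
    have "(z \<bullet> (Mz *v y)) = (z v* Mz) \<bullet> y" by (simp add: dot_lmul_matrix)
    then show ?thesis
      by (simp only: inner_vec_def vector_matrix_mult_def sum_distrib_right)
         (simp add: sum_distrib_left sum_distrib_right mult_ac)
  qed
  finally show "discrepancy Mz z (stack_vec (r *\<^sub>R u) (kron_vec u y)) $ i = ((r + z \<bullet> (Mz *v y)) *\<^sub>R u) $ i"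
    by (simp add: distrib_right)
qed

lemma breve_delta_eq:
  fixes Mz R :: "real^'n^'n" and ub :: "nat \<Rightarrow> 'a \<Rightarrow> real^'m"
  assumes "invertible Mz" and "transpose R = R"
  shows "breve_delta Mz R zt K zb ub z \<omega> = (\<Sum>k=1..K. (zb k \<bullet> (R *v (z - zt))) *\<^sub>R ub k \<omega>)"
proof -
  have "breve_delta Mz R zt K zb ub z \<omega>
      = (\<Sum>k=1..K. discrepancy Mz z (stack_vec (breve_s R zt zb k *\<^sub>R ub k \<omega>) (kron_vec (ub k \<omega>) (breve_y Mz R zb k))))"
    unfolding breve_delta_def breve_theta_def discrepancy_def
    by (rule linear_sum[OF matrix_vector_mul_linear])
  also have "\<dots> = (\<Sum>k=1..K. (zb k \<bullet> (R *v (z - zt))) *\<^sub>R ub k \<omega>)"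
    unfolding discrepancy_stack_kron breve_s_def breve_y_def matrix_inv_mult_vec[OF assms(1)]
      symmetric_inner[OF assms(2), symmetric]
    by (simp add: matrix_vector_mult_diff_distrib inner_simps inner_commute[of "zb _"] symmetric_inner[OF assms(2)])
  finally show ?thesis .
qed

section \<open>The scale factor as the norm of an orthogonal part\<close>

text \<open>Passing to differences with one of the vectors costs at most one dimension. For
  linearly independent \<open>zs 1, \<dots>, zs N\<close> this leaves \<open>N - 1\<close> dimensions to the \<open>N - 1\<close> vectors
  \<open>zs l - zt\<close>, which are therefore linearly independent too.\<close>

lemma dim_le_Suc_dim_diffs:
  fixes S :: "'a::euclidean_space set"
  shows "dim (insert a S) \<le> Suc (dim ((\<lambda>x. x - a) ` S))"
proof -
  have "insert a S \<subseteq> span (insert a ((\<lambda>x. x - a) ` S))"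
  proof -
    have "x \<in> span (insert a ((\<lambda>x. x - a) ` S))" if "x \<in> S" for x
    proof -
      have "a + (x - a) \<in> span (insert a ((\<lambda>x. x - a) ` S))"
        using that by (intro span_add) (auto intro: span_base)
      then show ?thesis by simp
    qed
    then show ?thesis by (auto intro: span_base)
  qed
  then have "dim (insert a S) \<le> dim (insert a ((\<lambda>x. x - a) ` S))"
    by (rule dim_mono)
  also have "\<dots> \<le> Suc (dim ((\<lambda>x. x - a) ` S))"
    by (simp add: dim_insert)
  finally show ?thesis .
qed

text \<open>The dimension bound forces the orthonormal \<open>b k\<close> and \<open>T\<close> to span the whole space, so
  \<open>w\<close> splits as \<open>s + t\<close> with \<open>s\<close> in the span of the \<open>b k\<close> and \<open>t\<close> in that of \<open>T\<close>. The
  formula for the sum is Parseval's identity for \<open>s = w - t\<close>, whose squared norm is \<open>w \<bullet> (w - t)\<close> because \<open>s\<close> is orthogonal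
  to \<open>t\<close>.\<close>

lemma sum_inner_squared_orthogonal_part:
  fixes b :: "'i \<Rightarrow> 'a::euclidean_space"
  assumes I: "finite I"
    and on: "\<And>j k. j \<in> I \<Longrightarrow> k \<in> I \<Longrightarrow> b j \<bullet> b k = (if j = k then 1 else 0)"
    and orth: "\<And>k t. k \<in> I \<Longrightarrow> t \<in> T \<Longrightarrow> b k \<bullet> t = 0"
    and dim: "DIM('a) \<le> card I + dim T"
  obtains t where "t \<in> span T" "\<And>v. v \<in> span T \<Longrightarrow> v \<bullet> (w - t) = 0"
    "(\<Sum>k\<in>I. (b k \<bullet> w)\<^sup>2) = w \<bullet> (w - t)"
proof -
  have inj: "inj_on b I"
    using on by (metis inj_onI zero_neq_one)
  have "independent (b ` I)"
  proof (rule pairwise_orthogonal_independent)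
    show "pairwise orthogonal (b ` I)"
      using on by (auto simp: pairwise_def orthogonal_def)
    show "0 \<notin> b ` I"
      using on by (metis imageE inner_zero_left zero_neq_one)
  qed
  then have "dim (b ` I) = card I"
    using inj by (simp add: dim_eq_card_independent card_image)
  moreover have "dim (b ` I \<union> T) = dim (b ` I) + dim T"
    using orth by (intro dim_orthogonal_sum) auto
  ultimately have "dim (b ` I \<union> T) = DIM('a)"
    using dim dim_subset_UNIV[of "b ` I \<union> T"] by linarith
  then have "w \<in> span (b ` I \<union> T)"
    by (simp add: dim_eq_full)
  then obtain s t where w: "w = s + t" and s: "s \<in> span (b ` I)" and t: "t \<in> span T"
    by (auto simp: span_Un)
  have bT: "b k \<bullet> v = 0" if "k \<in> I" "v \<in> span T" for k v
    using orthogonal_to_span[OF that(2), of "b k"] orth[OF that(1)]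
    by (auto simp: orthogonal_def)
  have sT: "s \<bullet> v = 0" if "v \<in> span T" for v
  proof -
    have "orthogonal v s"
      using bT that by (intro orthogonal_to_span[OF s]) (auto simp: orthogonal_def inner_commute)
    then show ?thesis by (simp add: orthogonal_def inner_commute)
  qed
  obtain u where u: "s = (\<Sum>k\<in>I. u k *\<^sub>R b k)"
  proof -
    obtain c where "s = (\<Sum>v\<in>b ` I. c v *\<^sub>R v)"
      using s unfolding span_finite[OF finite_imageI[OF I]] by blast
    then have "s = (\<Sum>k\<in>I. c (b k) *\<^sub>R b k)"
      by (simp only: sum.reindex[OF inj] comp_def)
    then show thesis by (rule that)
  qed
  have "b k \<bullet> w = u k" if "k \<in> I" for k
  proof -
    have "b k \<bullet> w = (\<Sum>j\<in>I. u j * (b k \<bullet> b j))"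
      using bT[OF that t] by (simp add: w u inner_sum_right inner_add_right)
    also have "\<dots> = (\<Sum>j\<in>I. if j = k then u k else 0)"
      using on that by (intro sum.cong) auto
    finally show ?thesis using I that by simp
  qed
  moreover have "w \<bullet> (w - t) = (\<Sum>k\<in>I. u k * (b k \<bullet> w))"
    by (simp add: w u inner_sum_left inner_commute)
  ultimately have "(\<Sum>k\<in>I. (b k \<bullet> w)\<^sup>2) = w \<bullet> (w - t)"
    by (simp add: power2_eq_square)
  with t sT show thesis
    by (intro that[of t]) (auto simp: w inner_commute)
qed

lemma column_Z_c: "column i (Z_c col zs zt) = zs (col i) - zt"
  by (simp add: column_def Z_c_def vec_eq_iff)

text \<open>Let \<open>t\<close> be the part of \<open>w = R (z - zt)\<close> in the column space of \<open>B = R Z\<close>, so \<open>t = B x\<close> for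
  some \<open>x\<close>. As \<open>w - t\<close> is orthogonal to the columns of \<open>B\<close>, the normal equations
  \<open>B\<^sup>T B x = B\<^sup>T w\<close> hold, and the inverse in \<open>gamma_matrix\<close> returns exactly this \<open>x\<close>. So the quadratic form
  of \<open>gamma_matrix\<close> at \<open>z - zt\<close> is \<open>w \<bullet> (w - t)\<close>. For \<open>N = 1\<close> there are no columns and \<open>t = 0\<close>.\<close>

lemma gamma_squared:
  fixes Wz R :: "real^'n^'n" and col :: "'c::finite \<Rightarrow> nat"
  assumes "spd R" and RR: "R ** R = matrix_inv Wz"
    and N: "N \<ge> 1"
    and inj: "inj_on zs {1..N}" and ind: "independent (zs ` {1..N})" and zt: "zs 1 = zt"
    and col: "N \<noteq> 1 \<Longrightarrow> bij_betw col UNIV {2..N}"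
    and on: "\<And>j k. j \<in> {1..CARD('n) - N + 1} \<Longrightarrow> k \<in> {1..CARD('n) - N + 1} \<Longrightarrow>
           zb j \<bullet> zb k = (if j = k then 1 else 0)"
    and orth: "\<And>k l. k \<in> {1..CARD('n) - N + 1} \<Longrightarrow> l \<in> {2..N} \<Longrightarrow>
           orthogonal (zb k) (R *v (zs l - zt))"
  shows "(z - zt) \<bullet> (gamma_matrix Wz N col zs zt *v (z - zt))
       = (\<Sum>k=1..CARD('n) - N + 1. (zb k \<bullet> (R *v (z - zt)))\<^sup>2)"
proof -
  define w where "w = R *v (z - zt)"
  define T where "T = (\<lambda>l. R *v (zs l - zt)) ` {2..N}"
  have sym: "transpose R = R" using \<open>spd R\<close> by (simp add: spd_def)
  have injR: "inj ((*v) R)"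
    by (rule inj_on_inverseI[where g = "(*v) (matrix_inv R)"])
       (simp add: matrix_inv_mult_vec invertible_if_spd \<open>spd R\<close>)
  have cardN: "N = dim (zs ` {1..N})"
    using ind inj by (simp add: dim_eq_card_independent card_image)
  have Nn: "N \<le> CARD('n)"
    using dim_subset_UNIV[of "zs ` {1..N}"] cardN by simp
  have T_image: "T = (*v) R ` (\<lambda>x. x - zt) ` zs ` {2..N}"
    by (auto simp: T_def)
  have "{1..N} = insert 1 {2..N}" using N by auto
  then have "N \<le> Suc (dim ((\<lambda>x. x - zt) ` zs ` {2..N}))"
    using cardN dim_le_Suc_dim_diffs[of zt "zs ` {2..N}"] zt by simp
  also have "dim ((\<lambda>x. x - zt) ` zs ` {2..N}) = dim T"
    unfolding T_image by (rule dim_image_eq[symmetric]) (use injR in \<open>auto intro: inj_on_subset\<close>)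
  finally have dimT: "N \<le> Suc (dim T)" .
  obtain t where t: "t \<in> span T" and tT: "\<And>v. v \<in> span T \<Longrightarrow> v \<bullet> (w - t) = 0"
    and sum: "(\<Sum>k=1..CARD('n) - N + 1. (zb k \<bullet> w)\<^sup>2) = w \<bullet> (w - t)"
  proof (rule sum_inner_squared_orthogonal_part[where b = zb and I = "{1..CARD('n) - N + 1}" and T = T and w = w])
    show "DIM(real^'n) \<le> card {1..CARD('n) - N + 1} + dim T"
      using dimT Nn by simp
  qed (use on orth in \<open>auto simp: T_def orthogonal_def\<close>)
  have V: "matrix_inv Wz *v v = R *v (R *v v)" for v
    by (simp add: RR[symmetric] matrix_vector_mul_assoc)
  show ?thesis
  proof (cases "N = 1")
    case True
    then have "t = 0" using t by (simp add: T_def)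
    then show ?thesis
      using sum True by (simp add: gamma_matrix_def V symmetric_inner[OF sym, symmetric] w_def)
  next
    case False
    define Z where "Z = Z_c col zs zt"
    define B where "B = R ** Z"
    define G where "G = transpose Z ** matrix_inv Wz ** Z"
    have G: "G = transpose B ** B"
      by (simp add: G_def B_def RR[symmetric] matrix_transpose_mul sym matrix_mul_assoc)
    have colB: "columns B = T"
    proof -
      have "column i B = R *v (zs (col i) - zt)" for i
        by (simp add: B_def matrix_vector_mult_basis[symmetric] matrix_vector_mul_assoc[symmetric])
           (simp add: matrix_vector_mult_basis Z_def column_Z_c)
      moreover have "{2..N} = range col"
        using col[OF False] by (simp add: bij_betw_def)
      ultimately show ?thesis by (auto simp: columns_def T_def)
    qed
    have spanT: "span T = range ((*v) B)"
    proof -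
      have "T = (*v) B ` range (\<lambda>i. axis i 1)"
        using columns_image_basis[of B] colB by simp
      moreover have "span (range (\<lambda>i::'c. axis i (1::real))) = UNIV"
        using span_cart_basis[where 'a = real and 'b = 'c]
        by (simp add: span_vec_eq cart_basis_def full_SetCompr_eq)
      ultimately show ?thesis
        by (simp only: linear_span_image[OF matrix_vector_mul_linear])
    qed
    have "CARD('c) = N - 1"
      using bij_betw_same_card[OF col[OF False]] by simp
    then have "CARD('c) \<le> rank B"
      using dimT by (simp add: column_rank_def colB)
    then have injB: "inj ((*v) B)"
      using rank_bound[of B] by (simp add: full_rank_injective[symmetric])
    \<comment> \<open>The Gram matrix \<open>G\<close> is invertible because the columns of \<open>B\<close> are linearly independent.\<close>
    have "x = 0" if "G *v x = 0" for x
    proof -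
      have "(B *v x) \<bullet> (B *v x) = x \<bullet> (G *v x)"
        by (simp add: G matrix_vector_mul_assoc[symmetric] dot_lmul_matrix[symmetric] transpose_matrix_vector
            inner_commute)
      with that have "B *v x = B *v 0" by simp
      then show ?thesis by (rule injD[OF injB])
    qed
    then have invG: "invertible G"
      by (simp add: invertible_left_inverse matrix_left_invertible_ker)
    obtain x where x: "t = B *v x"
      using t spanT by auto
    have "transpose B *v (w - t) = 0"
    proof -
      have "y \<bullet> (transpose B *v (w - t)) = (B *v y) \<bullet> (w - t)" for y
        using dot_lmul_matrix[of "w - t" B y] by (simp add: transpose_matrix_vector inner_commute)
      then show ?thesis
        using tT spanT by (metis inner_eq_zero_iff rangeI)
    qed
    then have "transpose B *v w = G *v x"
      by (simp add: G x matrix_vector_mult_diff_distrib matrix_vector_mul_assoc)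
    then have Gx: "matrix_inv G *v (transpose B *v w) = x"
      by (simp add: matrix_inv_mult_vec invG)
    have "gamma_matrix Wz N col zs zt *v (z - zt) = R *v w - R *v (B *v (matrix_inv G *v (transpose B *v w)))"
      using False
      by (simp add: gamma_matrix_def Let_def Z_def[symmetric] G_def[symmetric] matrix_vector_mult_diff_rdistrib
          matrix_vector_mul_assoc[symmetric] V B_def w_def matrix_transpose_mul sym)
    then have "gamma_matrix Wz N col zs zt *v (z - zt) = R *v w - R *v t"
      by (simp only: Gx x)
    then have "(z - zt) \<bullet> (gamma_matrix Wz N col zs zt *v (z - zt)) = w \<bullet> (w - t)"
      by (simp add: w_def matrix_vector_mult_diff_distrib[symmetric] symmetric_inner[OF sym, symmetric])
    then show ?thesis using sum by (simp add: w_def)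
  qed
qed

section \<open>The distribution of the discrepancy\<close>

theorem theorem4p3:
  fixes Mz Wz R :: "real^'n^'n" and Wu :: "real^'m^'m"
    and N :: nat and zt :: "real^'n" and zs zb :: "nat \<Rightarrow> real^'n"
    and col :: "'c::finite \<Rightarrow> nat"
    and P :: "'a measure" and ub :: "nat \<Rightarrow> 'a \<Rightarrow> real^'m"
    and Q :: "'b measure" and nu :: "'b \<Rightarrow> real^'m"
    and z :: "real^'n"
  assumes "N \<ge> 1"
    and "spd Mz" and "spd Wu" and "spd Wz"
    and "spd R" and "R ** R = matrix_inv Wz"
    and "inj_on zs {1..N}" and "independent (zs ` {1..N})" and "zs 1 = zt"
    and "N \<noteq> 1 \<Longrightarrow> bij_betw col UNIV {2..N}"
    and "\<And>j k. j \<in> {1..CARD('n) - N + 1} \<Longrightarrow> k \<in> {1..CARD('n) - N + 1} \<Longrightarrow>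
           zb j \<bullet> zb k = (if j = k then 1 else 0)"
    and "\<And>k l. k \<in> {1..CARD('n) - N + 1} \<Longrightarrow> l \<in> {2..N} \<Longrightarrow>
           orthogonal (zb k) (R *v (zs l - zt))"
    and "prob_space P"
    and "\<And>k. k \<in> {1..CARD('n) - N + 1} \<Longrightarrow>
           distributed P lborel (ub k) (\<lambda>x. ennreal (gaussian_density (matrix_inv Wu) x))"
    and "prob_space.indep_vars P (\<lambda>_. borel) ub {1..CARD('n) - N + 1}"
    and "prob_space Q"
    and "distributed Q lborel nu (\<lambda>x. ennreal (gaussian_density (matrix_inv Wu) x))"
  shows "distr P borel (breve_delta Mz R zt (CARD('n) - N + 1) zb ub z) =
         distr Q borel (\<lambda>\<omega>. gamma Wz N col zs zt z *\<^sub>R nu \<omega>)"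
proof -
  let ?K = "CARD('n) - N + 1"
  define f where "f = (\<lambda>x::real^'m. ennreal (gaussian_density (matrix_inv Wu) x))"
  define \<mu> where "\<mu> = density lborel f"
  define w where "w = R *v (z - zt)"
  interpret P: prob_space P by fact
  interpret Q: prob_space Q by fact
  have f[measurable]: "f \<in> borel_measurable borel"
    using distributed_borel_measurable[OF assms(17)] by (simp add: f_def)
  have lborel_law: "distr M lborel X = distr M borel X" for M :: "'x measure" and X :: "'x \<Rightarrow> real^'m"
    by (rule distr_cong) simp_all
  have law_nu: "distr Q borel nu = \<mu>"
    using distributed_distr_eq_density[OF assms(17)]
    by (simp add: \<mu>_def f_def lborel_law)
  have law_ub: "distr P borel (ub k) = \<mu>" if "k \<in> {1..?K}" for k
    using distributed_distr_eq_density[OF assms(14)[OF that]]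
    by (simp add: \<mu>_def f_def lborel_law)
  have nu[measurable]: "nu \<in> borel_measurable Q"
    using distributed_measurable[OF assms(17)] by simp
  have prob: "prob_space \<mu>"
    using Q.prob_space_distr[OF nu] by (simp add: law_nu)
  have rotate: "f x * f y = f (c *\<^sub>R x + s *\<^sub>R y) * f (c *\<^sub>R y - s *\<^sub>R x)"
    if "c\<^sup>2 + s\<^sup>2 = 1" for c s x y
    unfolding f_def by (rule gaussian_density_rotate[OF that])
  have sym: "transpose R = R" using \<open>spd R\<close> by (simp add: spd_def)
  have gamma_w: "gamma Wz N col zs zt z = sqrt (\<Sum>k=1..?K. (zb k \<bullet> w)\<^sup>2)"
    unfolding gamma_def w_def
    by (subst gamma_squared[OF assms(5,6,1,7,8,9,10,11,12)]) simp_all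
  have "distr P borel (breve_delta Mz R zt ?K zb ub z)
      = distr P borel (\<lambda>\<omega>. \<Sum>k=1..?K. (zb k \<bullet> w) *\<^sub>R ub k \<omega>)"
    unfolding w_def by (simp only: breve_delta_eq[OF invertible_if_spd[OF \<open>spd Mz\<close>] sym, abs_def])
  also have "\<dots> = distr \<mu> borel (\<lambda>x. gamma Wz N col zs zt z *\<^sub>R x)"
    unfolding gamma_w
    by (rule P.distr_sum_scaled_density[OF f rotate \<mu>_def prob _ assms(15) law_ub]) simp_all
  also have "\<dots> = distr Q borel (\<lambda>\<omega>. gamma Wz N col zs zt z *\<^sub>R nu \<omega>)"
    unfolding law_nu[symmetric] by (subst distr_distr) (simp_all add: comp_def)
  finally show ?thesis .
qed

end
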